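(* Let $K=[k_{ij}]$ be a real $r\times r$ matrix such that: (i) $k_{ij}\ge 0$ whenever $i\ne j$; (ii) $\sum_{i=1}^r k_{ij}=0$ for every $j=1,\dots,r$; (iii) for any $i_0\ne i_1$ in $\{1,\dots,r\}$ there is a sequence of indices $j_1,j_2,\dots,j_l$ with $j_1=i_0$, $j_l=i_1$ and $k_{j_m j_{m+1}}>0$ for $1\le m\le l-1$. Let $\Lambda=\mathrm{diag}(\lambda_1,\dots,\lambda_r)$ be a real diagonal matrix. Then there exist a positive definite diagonal $r\times r$ matrix $A_0$, an orthogonal $r\times r$ matrix $P$, and a positive definite diagonal $(r-1)\times(r-1)$ matrix $S$ such that $$A_0\Lambda=\Lambda A_0,\qquad A_0K+K^TA_0=-P^T\begin{pmatrix}0&0\\0&S\end{pmatrix}P.$$ Furthermore, the first column of $P^T$ is in the kernel of $K$.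
   Context: The block matrix $\begin{pmatrix}0&0\\0&S\end{pmatrix}$ is $r\times r$, with upper-left block of size $1\times 1$. The superscript $T$ denotes transpose. All matrices are real. *)

theory Defs
  imports Complex_Main "Jordan_Normal_Form.Matrix_Kernel"
begin

(* Symmetry is part of positive definiteness. The empty (0 x 0) matrix is positive definite. *)
definition pos_def_mat :: "nat \<Rightarrow> real mat \<Rightarrow> bool" where
  "pos_def_mat n A \<longleftrightarrow>
     A \<in> carrier_mat n n \<and> transpose_mat A = A \<and>
     (\<forall>v\<in>carrier_vec n. v \<noteq> 0\<^sub>v n \<longrightarrow> v \<bullet> (A *\<^sub>v v) > 0)"

(* The orthogonal_mat of Jordan_Normal_Form only asks for nonzero, pairwise orthogonal columns;
   here the columns are orthonormal. *)
definition real_orthogonal_mat :: "nat \<Rightarrow> real mat \<Rightarrow> bool" where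
  "real_orthogonal_mat n P \<longleftrightarrow>
     P \<in> carrier_mat n n \<and> transpose_mat P * P = 1\<^sub>m n \<and> P * transpose_mat P = 1\<^sub>m n"

end

theory Submission
  imports Defs "Jordan_Normal_Form.Spectral_Radius"
begin

text \<open>
  The column sums make \<open>K\<close> singular, and a Perron-Frobenius argument supplies a kernel vector \<open>p\<close>
  with strictly positive entries (\<open>positive_kernel_vector\<close>). The scaling
  \<open>A\<^sub>0 = diag (1 / p\<^sub>i)\<close> is chosen to make \<open>A\<^sub>0 p\<close> the all-ones vector: \<open>K\<^sup>T\<close> vanishes on
  that one, so that \<open>p\<close> lies in the kernel of \<open>A\<^sub>0 K + K\<^sup>T A\<^sub>0\<close> too. In the
  coordinates \<open>y\<^sub>i = v\<^sub>i / p\<^sub>i\<close> the quadratic form of \<open>A\<^sub>0 K + K\<^sup>T A\<^sub>0\<close> at \<open>v\<close> is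
  \<open>- (\<Sum>i j. K\<^sub>i\<^sub>j p\<^sub>j (y\<^sub>i - y\<^sub>j)\<^sup>2)\<close> (\<open>lyapunov_form\<close>). Hence it is never positive, and since
  positive entries of \<open>K\<close> connect all indices, it vanishes only when \<open>y\<close> is constant, that is, on
  the multiples of \<open>p\<close> (\<open>lyapunov_form_nonneg_imp_multiple\<close>).

  So \<open>N = - (A\<^sub>0 K + K\<^sup>T A\<^sub>0)\<close> is symmetric and positive semidefinite with one-dimensional kernel.
  Orthogonal diagonalization with the normalised \<open>p\<close> as first eigenvector
  (\<open>orthogonal_diagonalization_from_eigenvector\<close>) writes it as \<open>P\<^sup>T diag (0, S) P\<close>, and \<open>S\<close> is
  positive definite because the kernel is already used up by the first column of \<open>P\<^sup>T\<close>. That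
  column is a multiple of \<open>p\<close>, so \<open>K\<close> vanishes on it; and diagonal matrices commute.

  The spectral theorem for real symmetric matrices is proved by induction on the dimension: a real
  eigenvector comes from a complex eigenvalue, and a Householder reflection splits it off.
\<close>

section \<open>Spectral theorem for real symmetric matrices\<close>

lemma scalar_prod_self_eq_0_iff:
  fixes v :: "real vec"
  assumes "v \<in> carrier_vec n"
  shows "v \<bullet> v = 0 \<longleftrightarrow> v = 0\<^sub>v n"
proof -
  have "v \<bullet> v = (\<Sum>i<n. v $ i * v $ i)"
    using assms by (simp add: scalar_prod_def lessThan_atLeast0)
  also have "\<dots> = 0 \<longleftrightarrow> (\<forall>i<n. v $ i = 0)"
    by (subst sum_nonneg_eq_0_iff) auto
  also have "\<dots> \<longleftrightarrow> v = 0\<^sub>v n" using assms by (auto intro!: eq_vecI)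
  finally show ?thesis .
qed

lemma scalar_prod_self_nonneg: "(v :: real vec) \<bullet> v \<ge> 0"
  by (simp add: scalar_prod_def sum_nonneg)

lemma symmetric_mat_scalar_prod:
  fixes A :: "real mat"
  assumes "A \<in> carrier_mat n n" "transpose_mat A = A" "x \<in> carrier_vec n" "y \<in> carrier_vec n"
  shows "(A *\<^sub>v x) \<bullet> y = x \<bullet> (A *\<^sub>v y)"
  using transpose_vec_mult_scalar[OF assms(1,4,3)] assms(2) by simp

text \<open>
  Over the complex numbers some eigenvalue \<open>k\<close> exists, with eigenvector \<open>x + i y\<close>. Comparing
  \<open>A x \<bullet> y\<close> with \<open>x \<bullet> A y\<close> gives \<open>Im k * (x \<bullet> x + y \<bullet> y) = 0\<close>. So \<open>k\<close> is real, and
  whichever of \<open>x\<close> and \<open>y\<close> is nonzero can be normalised to a real unit eigenvector.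
\<close>

lemma real_symmetric_eigenvector:
  fixes A :: "real mat"
  assumes A: "A \<in> carrier_mat n n" and sym: "transpose_mat A = A" and n: "n > 0"
  obtains a u where "u \<in> carrier_vec n" "u \<bullet> u = 1" "A *\<^sub>v u = a \<cdot>\<^sub>v u"
proof -
  let ?C = "map_mat complex_of_real A"
  have C: "?C \<in> carrier_mat n n" using A by simp
  obtain k where "eigenvalue ?C k"
    using spectrum_non_empty[OF C] n by (auto simp: spectrum_def)
  then obtain z where z: "z \<in> carrier_vec n" "z \<noteq> 0\<^sub>v n" and ev: "?C *\<^sub>v z = k \<cdot>\<^sub>v z"
    using C by (auto simp: eigenvalue_def eigenvector_def)
  define x where "x = map_vec Re z"
  define y where "y = map_vec Im z"
  have x: "x \<in> carrier_vec n" and y: "y \<in> carrier_vec n"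
    using z by (auto simp: x_def y_def)
  have comp: "(\<Sum>j = 0..<n. complex_of_real (A $$ (i, j)) * z $ j) = k * z $ i" if "i < n" for i
    using arg_cong[OF ev, of "\<lambda>v. v $ i"] that A z(1) by (simp add: scalar_prod_def)
  have Ax: "A *\<^sub>v x = Re k \<cdot>\<^sub>v x - Im k \<cdot>\<^sub>v y"
  proof (rule eq_vecI)
    fix i assume "i < dim_vec (Re k \<cdot>\<^sub>v x - Im k \<cdot>\<^sub>v y)"
    then have i: "i < n" using y by simp
    show "(A *\<^sub>v x) $ i = (Re k \<cdot>\<^sub>v x - Im k \<cdot>\<^sub>v y) $ i"
      using arg_cong[OF comp[OF i], of Re] i A z(1)
      by (simp add: x_def y_def scalar_prod_def)
  qed (use A y in auto)
  have Ay: "A *\<^sub>v y = Re k \<cdot>\<^sub>v y + Im k \<cdot>\<^sub>v x"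
  proof (rule eq_vecI)
    fix i assume "i < dim_vec (Re k \<cdot>\<^sub>v y + Im k \<cdot>\<^sub>v x)"
    then have i: "i < n" using x by simp
    show "(A *\<^sub>v y) $ i = (Re k \<cdot>\<^sub>v y + Im k \<cdot>\<^sub>v x) $ i"
      using arg_cong[OF comp[OF i], of Im] i A z(1)
      by (simp add: x_def y_def scalar_prod_def)
  qed (use A x in auto)
  have "x \<noteq> 0\<^sub>v n \<or> y \<noteq> 0\<^sub>v n"
  proof (rule ccontr)
    assume "\<not> ?thesis"
    then have *: "x = 0\<^sub>v n" "y = 0\<^sub>v n" by auto
    have "z $ i = 0" if "i < n" for i
      using arg_cong[OF *(1), of "\<lambda>v. v $ i"] arg_cong[OF *(2), of "\<lambda>v. v $ i"] that z(1)
      by (simp add: x_def y_def complex_eq_iff)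
    then have "z = 0\<^sub>v n" using z(1) by (auto intro!: eq_vecI)
    then show False using z(2) by simp
  qed
  then have pos: "x \<bullet> x + y \<bullet> y > 0"
    using scalar_prod_self_eq_0_iff[OF x] scalar_prod_self_eq_0_iff[OF y]
      scalar_prod_self_nonneg[of x] scalar_prod_self_nonneg[of y] by linarith
  have "(A *\<^sub>v x) \<bullet> y = x \<bullet> (A *\<^sub>v y)" by (rule symmetric_mat_scalar_prod[OF A sym x y])
  moreover have "(A *\<^sub>v x) \<bullet> y = Re k * (x \<bullet> y) - Im k * (y \<bullet> y)"
    unfolding Ax using x y by (simp add: minus_scalar_prod_distrib)
  moreover have "x \<bullet> (A *\<^sub>v y) = Re k * (x \<bullet> y) + Im k * (x \<bullet> x)"
    unfolding Ay using x y by (simp add: scalar_prod_add_distrib)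
  ultimately have "Im k * (x \<bullet> x + y \<bullet> y) = 0" by (simp add: algebra_simps)
  then have "Im k = 0" using pos by simp
  then have "A *\<^sub>v x = Re k \<cdot>\<^sub>v x" "A *\<^sub>v y = Re k \<cdot>\<^sub>v y"
    using Ax Ay x y by (auto intro!: eq_vecI)
  then obtain w where w: "w \<in> carrier_vec n" "w \<noteq> 0\<^sub>v n" "A *\<^sub>v w = Re k \<cdot>\<^sub>v w"
    using \<open>x \<noteq> 0\<^sub>v n \<or> y \<noteq> 0\<^sub>v n\<close> x y by blast
  have ww: "w \<bullet> w > 0"
    using scalar_prod_self_eq_0_iff[OF w(1)] scalar_prod_self_nonneg[of w] w(2) by linarith
  define u where "u = (1 / sqrt (w \<bullet> w)) \<cdot>\<^sub>v w"
  show ?thesis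
  proof
    show "u \<in> carrier_vec n" using w by (simp add: u_def)
    show "u \<bullet> u = 1" using w ww by (simp add: u_def)
    show "A *\<^sub>v u = Re k \<cdot>\<^sub>v u"
      unfolding u_def using A w by (simp add: mult_mat_vec[OF A] smult_smult_assoc mult.commute)
  qed
qed

text \<open>
  The Householder reflection that exchanges \<open>u\<close> with the first basis vector \<open>e\<close> does it:
  \<open>Q = 1 - (2 / (w \<bullet> w)) w w\<^sup>T\<close> with \<open>w = u - e\<close>. For \<open>u = e\<close> the convention \<open>2 / 0 = 0\<close>
  turns this formula into the identity matrix, which is then the right choice.
\<close>

lemma orthogonal_mat_with_first_column:
  fixes u :: "real vec"
  assumes u: "u \<in> carrier_vec n" "u \<bullet> u = 1" and n: "n > 0"
  obtains Q where "real_orthogonal_mat n Q" "col Q 0 = u"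
proof -
  define w where "w = u - unit_vec n 0"
  define s where "s = w \<bullet> w"
  define c where "c = 2 / s"
  define Q where "Q = mat n n (\<lambda>(i, j). (if i = j then 1 else 0) - c * w $ i * w $ j)"
  have w: "w \<in> carrier_vec n" using u by (simp add: w_def)
  have Q: "Q \<in> carrier_mat n n" by (simp add: Q_def)
  have symQ: "transpose_mat Q = Q" by (auto simp: Q_def intro!: eq_matI)
  have s_sum: "s = (\<Sum>k = 0..<n. w $ k * w $ k)"
    using w by (simp add: s_def scalar_prod_def)
  have s_val: "s = 2 - 2 * u $ 0"
  proof -
    have "s = u \<bullet> u - u $ 0 - (u $ 0 - 1)"
      unfolding s_def w_def using u n
      by (simp add: minus_scalar_prod_distrib[of _ n] scalar_prod_minus_distrib[of _ n])
    then show ?thesis using u by simp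
  qed
  have QQ: "Q * Q = 1\<^sub>m n"
  proof -
    define W where "W = mat n n (\<lambda>(i, j). c * w $ i * w $ j)"
    have W: "W \<in> carrier_mat n n" by (simp add: W_def)
    have QW: "Q = 1\<^sub>m n - W" by (auto simp: Q_def W_def intro!: eq_matI)
    have ccs: "c * (c * s) = 2 * c" by (simp add: c_def)
    have WW: "W * W = W + W"
    proof (rule eq_matI)
      fix i j assume "i < dim_row (W + W)" "j < dim_col (W + W)"
      then have ij: "i < n" "j < n" using W by auto
      have "(W * W) $$ (i, j) = (\<Sum>k = 0..<n. (c * w $ i * w $ k) * (c * w $ k * w $ j))"
        using ij by (simp add: W_def scalar_prod_def)
      also have "\<dots> = c * (c * s) * (w $ i * w $ j)"
        unfolding s_sum sum_distrib_left sum_distrib_right by (rule sum.cong) auto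
      also have "\<dots> = (W + W) $$ (i, j)"
        unfolding ccs using ij by (simp add: W_def)
      finally show "(W * W) $$ (i, j) = (W + W) $$ (i, j)" .
    qed (use W in auto)
    have "Q * Q = (1\<^sub>m n - W) - (W - W * W)"
      unfolding QW using W
      by (simp add: minus_mult_distrib_mat[of _ n n _ _ n] mult_minus_distrib_mat[of _ n n _ n]
          minus_carrier_mat)
    then show ?thesis unfolding WW using W by (auto intro!: eq_matI)
  qed
  have "col Q 0 = u"
  proof (rule eq_vecI)
    fix i assume "i < dim_vec u"
    then have i: "i < n" using u by simp
    have wi: "w $ i = u $ i - (if i = 0 then 1 else 0)" and w0: "w $ 0 = u $ 0 - 1"
      using i n u by (auto simp: w_def)
    have "c * w $ i * w $ 0 = - w $ i"
    proof (cases "s = 0")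
      case False
      have "w $ 0 = - s / 2" using s_val w0 by simp
      then show ?thesis using False by (simp add: c_def)
    next
      case True
      then have "w = 0\<^sub>v n" using scalar_prod_self_eq_0_iff[OF w] by (simp add: s_def)
      then show ?thesis using i by simp
    qed
    then show "col Q 0 $ i = u $ i" using i n wi by (simp add: Q_def)
  qed (use Q u in auto)
  moreover have "real_orthogonal_mat n Q"
    using Q QQ by (simp add: real_orthogonal_mat_def symQ)
  ultimately show ?thesis using that by blast
qed

lemma real_orthogonal_mat_mult:
  assumes "real_orthogonal_mat n P" "real_orthogonal_mat n Q"
  shows "real_orthogonal_mat n (P * Q)"
proof -
  have P: "P \<in> carrier_mat n n" "transpose_mat P * P = 1\<^sub>m n" "P * transpose_mat P = 1\<^sub>m n"
    and Q: "Q \<in> carrier_mat n n" "transpose_mat Q * Q = 1\<^sub>m n" "Q * transpose_mat Q = 1\<^sub>m n"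
    using assms by (auto simp: real_orthogonal_mat_def)
  have t: "transpose_mat (P * Q) = transpose_mat Q * transpose_mat P"
    by (rule transpose_mult[OF P(1) Q(1)])
  have "transpose_mat (P * Q) * (P * Q) = transpose_mat Q * (transpose_mat P * P) * Q"
    unfolding t using P(1) Q(1) by (simp add: assoc_mult_mat[of _ n n _ n _ n])
  moreover have "(P * Q) * transpose_mat (P * Q) = P * (Q * transpose_mat Q) * transpose_mat P"
    unfolding t using P(1) Q(1) by (simp add: assoc_mult_mat[of _ n n _ n _ n])
  ultimately show ?thesis using P Q by (simp add: real_orthogonal_mat_def)
qed

text \<open>
  The first column of \<open>Q\<^sup>T M Q\<close> is \<open>Q\<^sup>T (a q) = a e\<close>, where \<open>q\<close> is the first column of \<open>Q\<close>
  and \<open>e\<close> the first basis vector; symmetry then clears the rest of the first row.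
\<close>

lemma deflation:
  fixes M :: "real mat"
  assumes M: "M \<in> carrier_mat (Suc m) (Suc m)" and sym: "transpose_mat M = M"
    and Q: "real_orthogonal_mat (Suc m) Q" and ev: "M *\<^sub>v col Q 0 = a \<cdot>\<^sub>v col Q 0"
  obtains M' where "M' \<in> carrier_mat m m" "transpose_mat M' = M'"
    "transpose_mat Q * M * Q = four_block_mat (a \<cdot>\<^sub>m 1\<^sub>m 1) (0\<^sub>m 1 m) (0\<^sub>m m 1) M'"
proof -
  let ?n = "Suc m"
  have Qc: "Q \<in> carrier_mat ?n ?n" and QQ: "transpose_mat Q * Q = 1\<^sub>m ?n"
    using Q by (auto simp: real_orthogonal_mat_def)
  define B where "B = transpose_mat Q * M * Q"
  have B: "B \<in> carrier_mat ?n ?n" using M Qc by (simp add: B_def)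
  have symB: "transpose_mat B = B"
    unfolding B_def using M Qc sym
    by (simp add: transpose_mult[of _ ?n ?n _ ?n] assoc_mult_mat[of _ ?n ?n _ ?n _ ?n])
  have "col B 0 = transpose_mat Q *\<^sub>v (M *\<^sub>v col Q 0)"
    unfolding B_def using M Qc
    by (subst col_mult2[of _ ?n ?n _ ?n]) (auto intro!: assoc_mult_mat_vec intro: col_carrier_vec)
  also have "\<dots> = a \<cdot>\<^sub>v (transpose_mat Q *\<^sub>v col Q 0)"
    unfolding ev using Qc by (intro mult_mat_vec[of _ ?n ?n]) (auto intro: col_carrier_vec)
  also have "transpose_mat Q *\<^sub>v col Q 0 = unit_vec ?n 0"
    using col_mult2[of "transpose_mat Q" ?n ?n Q ?n 0] Qc QQ by simp
  finally have "col B 0 = a \<cdot>\<^sub>v unit_vec ?n 0" .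
  then have "col B 0 $ i = (a \<cdot>\<^sub>v unit_vec ?n 0) $ i" for i by simp
  then have col0: "B $$ (i, 0) = (if i = 0 then a else 0)" if "i < ?n" for i
    using that B by (subst index_col[symmetric]) auto
  have symB': "B $$ (i, j) = B $$ (j, i)" if "i < ?n" "j < ?n" for i j
    using that B arg_cong[OF symB, of "\<lambda>X. X $$ (j, i)"] by simp
  define M' where "M' = mat m m (\<lambda>(i, j). B $$ (Suc i, Suc j))"
  show ?thesis
  proof
    show "M' \<in> carrier_mat m m" by (simp add: M'_def)
    show "transpose_mat M' = M'"
      by (rule eq_matI) (auto simp: M'_def intro: symB')
    show "transpose_mat Q * M * Q = four_block_mat (a \<cdot>\<^sub>m 1\<^sub>m 1) (0\<^sub>m 1 m) (0\<^sub>m m 1) M'"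
      unfolding B_def[symmetric]
    proof (rule eq_matI, goal_cases)
      case (1 i j)
      then have ij: "i < ?n" "j < ?n" by (auto simp: M'_def)
      show ?case
      proof (cases "i = 0 \<or> j = 0")
        case True
        then show ?thesis using ij col0[of i] col0[of j] symB'[of 0 j] by (auto simp: M'_def)
      next
        case False
        then show ?thesis using ij by (auto simp: M'_def)
      qed
    qed (use B in \<open>auto simp: M'_def\<close>)
  qed
qed

text \<open>
  This serves twice: as the induction step of the spectral theorem, and, with the kernel vector of
  the Lyapunov matrix for \<open>u\<close>, to choose which eigenvector becomes the first column. The
  spectral theorem in the smaller dimension is therefore an assumption here.
\<close>

lemma orthogonal_diagonalization_from_eigenvector:
  fixes M :: "real mat"
  assumes M: "M \<in> carrier_mat (Suc m) (Suc m)" and sym: "transpose_mat M = M"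
    and u: "u \<in> carrier_vec (Suc m)" "u \<bullet> u = 1" and ev: "M *\<^sub>v u = a \<cdot>\<^sub>v u"
    and smaller: "\<And>M' :: real mat. \<lbrakk>M' \<in> carrier_mat m m; transpose_mat M' = M'\<rbrakk> \<Longrightarrow>
      \<exists>R. real_orthogonal_mat m R \<and> diagonal_mat (transpose_mat R * M' * R)"
  shows "\<exists>U D. real_orthogonal_mat (Suc m) U \<and> col U 0 = u \<and> D \<in> carrier_mat m m \<and> diagonal_mat D \<and>
    transpose_mat U * M * U = four_block_mat (a \<cdot>\<^sub>m 1\<^sub>m 1) (0\<^sub>m 1 m) (0\<^sub>m m 1) D"
proof -
  let ?n = "Suc m"
  obtain Q where Q: "real_orthogonal_mat ?n Q" and Q0: "col Q 0 = u"
    using orthogonal_mat_with_first_column[OF u] by blast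
  obtain M' where M': "M' \<in> carrier_mat m m" "transpose_mat M' = M'"
    and block: "transpose_mat Q * M * Q = four_block_mat (a \<cdot>\<^sub>m 1\<^sub>m 1) (0\<^sub>m 1 m) (0\<^sub>m m 1) M'"
    using deflation[OF M sym Q, of a] ev Q0 by blast
  obtain R where R: "real_orthogonal_mat m R" and diag: "diagonal_mat (transpose_mat R * M' * R)"
    using smaller[OF M'] by blast
  define F where "F = four_block_mat (1\<^sub>m 1) (0\<^sub>m 1 m) (0\<^sub>m m 1) R"
  define D where "D = transpose_mat R * M' * R"
  have Rc: "R \<in> carrier_mat m m" "transpose_mat R * R = 1\<^sub>m m" "R * transpose_mat R = 1\<^sub>m m"
    using R by (auto simp: real_orthogonal_mat_def)
  have Qc: "Q \<in> carrier_mat ?n ?n" using Q by (simp add: real_orthogonal_mat_def)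
  have Fc: "F \<in> carrier_mat ?n ?n" using Rc(1) by (auto simp: F_def)
  have Ft: "transpose_mat F = four_block_mat (1\<^sub>m 1) (0\<^sub>m 1 m) (0\<^sub>m m 1) (transpose_mat R)"
    unfolding F_def using Rc(1) by (subst transpose_four_block_mat) auto
  have block_mult: "four_block_mat X (0\<^sub>m 1 m) (0\<^sub>m m 1) Y * four_block_mat X' (0\<^sub>m 1 m) (0\<^sub>m m 1) Y'
      = four_block_mat (X * X') (0\<^sub>m 1 m) (0\<^sub>m m 1) (Y * Y')"
    if "X \<in> carrier_mat 1 1" "X' \<in> carrier_mat 1 1" "Y \<in> carrier_mat m m" "Y' \<in> carrier_mat m m"
    for X Y X' Y' :: "real mat"
    by (subst mult_four_block_mat[of _ 1 1 _ m _ m _ _ 1 _ m]) (use that in auto)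
  have F: "real_orthogonal_mat ?n F"
    unfolding real_orthogonal_mat_def Ft
    using Fc Rc by (simp add: F_def block_mult del: One_nat_def) simp
  have "transpose_mat (Q * F) * M * (Q * F) = transpose_mat F * (transpose_mat Q * M * Q) * F"
    using Qc Fc M by (simp add: transpose_mult[of _ ?n ?n _ ?n] assoc_mult_mat[of _ ?n ?n _ ?n _ ?n])
  also have "\<dots> = four_block_mat (a \<cdot>\<^sub>m 1\<^sub>m 1) (0\<^sub>m 1 m) (0\<^sub>m m 1) D"
    unfolding block Ft using Rc M' by (simp add: F_def D_def block_mult del: One_nat_def)
  finally have "transpose_mat (Q * F) * M * (Q * F) = four_block_mat (a \<cdot>\<^sub>m 1\<^sub>m 1) (0\<^sub>m 1 m) (0\<^sub>m m 1) D" .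
  moreover have "col (Q * F) 0 = u"
  proof -
    have "col F 0 = unit_vec ?n 0" using Rc(1) by (auto simp: F_def intro!: eq_vecI)
    then have "col (Q * F) 0 = Q *\<^sub>v unit_vec ?n 0" using Qc Fc by (subst col_mult2[of _ ?n ?n _ ?n]) simp_all
    also have "\<dots> = col Q 0"
      using Qc by (intro eq_vecI) auto
    finally show ?thesis using Q0 by simp
  qed
  moreover have "D \<in> carrier_mat m m" "diagonal_mat D" using Rc M' diag by (auto simp: D_def)
  ultimately show ?thesis using real_orthogonal_mat_mult[OF Q F] by blast
qed

theorem real_symmetric_orthogonally_diagonalizable:
  fixes M :: "real mat"
  assumes "M \<in> carrier_mat n n" "transpose_mat M = M"
  shows "\<exists>R. real_orthogonal_mat n R \<and> diagonal_mat (transpose_mat R * M * R)"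
  using assms
proof (induction n arbitrary: M)
  case 0
  then show ?case
    by (intro exI[of _ "1\<^sub>m 0"]) (auto simp: real_orthogonal_mat_def diagonal_mat_def)
next
  case (Suc m)
  obtain a u where "u \<in> carrier_vec (Suc m)" "u \<bullet> u = 1" "M *\<^sub>v u = a \<cdot>\<^sub>v u"
    using real_symmetric_eigenvector[OF Suc.prems] by blast
  from orthogonal_diagonalization_from_eigenvector[OF Suc.prems this Suc.IH]
  obtain U D where "real_orthogonal_mat (Suc m) U" "D \<in> carrier_mat m m" "diagonal_mat D"
    "transpose_mat U * M * U = four_block_mat (a \<cdot>\<^sub>m 1\<^sub>m 1) (0\<^sub>m 1 m) (0\<^sub>m m 1) D"
    by blast
  then show ?case
    by (intro exI[of _ U]) (auto simp: diagonal_mat_def)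
qed

section \<open>Positive kernel vector\<close>

text \<open>
  Irreducibility in the form in which it gets used: a property that spreads along the positive
  entries of \<open>K\<close> and holds at one index holds at all of them.
\<close>

definition positively_connected :: "nat \<Rightarrow> real mat \<Rightarrow> bool" where
  "positively_connected n K \<longleftrightarrow>
    (\<forall>Q. (\<forall>i<n. \<forall>j<n. Q i \<longrightarrow> K $$ (i, j) > 0 \<longrightarrow> Q j) \<longrightarrow> (\<exists>i<n. Q i) \<longrightarrow> (\<forall>j<n. Q j))"

lemma positively_connectedD:
  assumes "positively_connected n K" "i < n" "j < n" "Q i"
    and "\<And>i j. \<lbrakk>i < n; j < n; Q i; K $$ (i, j) > 0\<rbrakk> \<Longrightarrow> Q j"
  shows "Q j"
  using assms unfolding positively_connected_def by blast

lemma positively_connected_if_chains: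
  assumes chain: "\<forall>i0<n. \<forall>i1<n. i0 \<noteq> i1 \<longrightarrow>
      (\<exists>js :: nat list. js \<noteq> [] \<and> set js \<subseteq> {..<n} \<and> hd js = i0 \<and> last js = i1 \<and>
        (\<forall>m. Suc m < length js \<longrightarrow> K $$ (js ! m, js ! Suc m) > 0))"
  shows "positively_connected n K"
  unfolding positively_connected_def
proof (intro allI impI)
  fix Q i1
  assume closed: "\<forall>i<n. \<forall>j<n. Q i \<longrightarrow> K $$ (i, j) > 0 \<longrightarrow> Q j"
    and "\<exists>i<n. Q i" and i1: "i1 < n"
  then obtain i0 where i0: "i0 < n" "Q i0" by blast
  show "Q i1"
  proof (cases "i0 = i1")
    case False
    then obtain js where js: "js \<noteq> []" "set js \<subseteq> {..<n}" "hd js = i0" "last js = i1"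
      "\<forall>m. Suc m < length js \<longrightarrow> K $$ (js ! m, js ! Suc m) > 0"
      using chain i0 i1 by blast
    have "Q (js ! m)" if "m < length js" for m
      using that
    proof (induction m)
      case 0
      then show ?case using js i0 by (simp add: hd_conv_nth)
    next
      case (Suc m)
      then have "js ! m \<in> {..<n}" "js ! Suc m \<in> {..<n}"
        using js(2) by (meson Suc_lessD nth_mem subsetD)+
      moreover have "Q (js ! m)" "K $$ (js ! m, js ! Suc m) > 0" using Suc js(5) by auto
      ultimately show ?case using closed by blast
    qed
    then have "Q (js ! (length js - 1))" using js(1) by simp
    then show ?thesis using js(1,4) by (simp add: last_conv_nth)
  qed (use i0 in simp)
qed

lemma mult_mat_vec_eq_sum:
  fixes K :: "real mat"
  assumes "K \<in> carrier_mat n n" "v \<in> carrier_vec n" "i < n"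
  shows "(K *\<^sub>v v) $ i = (\<Sum>j<n. K $$ (i, j) * v $ j)"
  using assms by (simp add: scalar_prod_def lessThan_atLeast0)

lemma transpose_mult_ones:
  fixes K :: "real mat"
  assumes "K \<in> carrier_mat n n" "\<And>j. j < n \<Longrightarrow> (\<Sum>i<n. K $$ (i, j)) = 0"
  shows "transpose_mat K *\<^sub>v vec n (\<lambda>_. 1) = 0\<^sub>v n"
  by (rule eq_vecI) (use assms in \<open>auto simp: scalar_prod_def lessThan_atLeast0\<close>)

text \<open>
  The columns of \<open>K\<close> sum to zero, so \<open>K\<close> is singular and has a kernel vector \<open>v\<close>. Isolating
  the diagonal term in row \<open>i\<close> of \<open>K v = 0\<close> and taking absolute values shows that
  \<open>p = \<bar>v\<bar>\<close> satisfies \<open>(K p)\<^sub>i \<ge> 0\<close>. These entries add up to zero, again because of the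
  column sums, so \<open>K p = 0\<close>. If \<open>p\<close> vanished at one index, row \<open>i\<close> of \<open>K p = 0\<close> would make it
  vanish at all \<open>j\<close> with \<open>K\<^sub>i\<^sub>j > 0\<close>, hence everywhere.
\<close>

lemma positive_kernel_vector:
  fixes K :: "real mat"
  assumes n: "n > 0" and K: "K \<in> carrier_mat n n"
    and off_diag: "\<And>i j. \<lbrakk>i < n; j < n; i \<noteq> j\<rbrakk> \<Longrightarrow> K $$ (i, j) \<ge> 0"
    and col_sums: "\<And>j. j < n \<Longrightarrow> (\<Sum>i<n. K $$ (i, j)) = 0"
    and conn: "positively_connected n K"
  obtains p where "p \<in> carrier_vec n" "K *\<^sub>v p = 0\<^sub>v n" "\<And>i. i < n \<Longrightarrow> p $ i > 0"
proof -
  let ?ones = "vec n (\<lambda>_. 1 :: real)"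
  have "transpose_mat K *\<^sub>v ?ones = 0\<^sub>v n"
    by (rule transpose_mult_ones[OF K col_sums])
  moreover have "?ones \<noteq> 0\<^sub>v n"
    using n by (auto simp: vec_eq_iff)
  ultimately have "det (transpose_mat K) = 0"
    using det_0_iff_vec_prod_zero_field[of "transpose_mat K" n] K
    by (metis transpose_carrier_mat vec_carrier)
  then have "det K = 0" using det_transpose[OF K] by simp
  then obtain v where v: "v \<in> carrier_vec n" "v \<noteq> 0\<^sub>v n" "K *\<^sub>v v = 0\<^sub>v n"
    using det_0_iff_vec_prod_zero_field[OF K] by auto
  define p where "p = vec n (\<lambda>i. \<bar>v $ i\<bar>)"
  have p: "p \<in> carrier_vec n" by (simp add: p_def)
  have split: "(\<Sum>j<n. f j) = f i + (\<Sum>j\<in>{..<n} - {i}. f j)" if "i < n" for f :: "nat \<Rightarrow> real" and i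
    using that by (simp add: sum.remove)
  have diag: "K $$ (i, i) \<le> 0" if "i < n" for i
  proof -
    have "(\<Sum>j\<in>{..<n} - {i}. K $$ (j, i)) \<ge> 0" using that by (intro sum_nonneg off_diag) auto
    then show ?thesis using split[OF that, of "\<lambda>j. K $$ (j, i)"] col_sums[OF that] by simp
  qed
  have nonneg: "(\<Sum>j<n. K $$ (i, j) * p $ j) \<ge> 0" if i: "i < n" for i
  proof -
    have "0 = (\<Sum>j<n. K $$ (i, j) * v $ j)"
      using mult_mat_vec_eq_sum[OF K v(1) i] v(3) i by simp
    then have "- K $$ (i, i) * v $ i = (\<Sum>j\<in>{..<n} - {i}. K $$ (i, j) * v $ j)"
      using split[OF i] by simp
    then have "- K $$ (i, i) * \<bar>v $ i\<bar> = \<bar>\<Sum>j\<in>{..<n} - {i}. K $$ (i, j) * v $ j\<bar>"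
      using diag[OF i] by (metis abs_mult abs_of_nonneg neg_0_le_iff_le)
    also have "\<dots> \<le> (\<Sum>j\<in>{..<n} - {i}. \<bar>K $$ (i, j) * v $ j\<bar>)" by (rule sum_abs)
    also have "\<dots> = (\<Sum>j\<in>{..<n} - {i}. K $$ (i, j) * p $ j)"
      using i off_diag by (intro sum.cong) (auto simp: p_def abs_mult)
    finally show ?thesis using split[OF i, of "\<lambda>j. K $$ (i, j) * p $ j"] i by (simp add: p_def)
  qed
  have "(\<Sum>i<n. \<Sum>j<n. K $$ (i, j) * p $ j) = (\<Sum>j<n. (\<Sum>i<n. K $$ (i, j)) * p $ j)"
    by (subst sum.swap) (simp add: sum_distrib_right)
  also have "\<dots> = 0" using col_sums by simp
  finally have Kp: "(\<Sum>j<n. K $$ (i, j) * p $ j) = 0" if "i < n" for i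
    using sum_nonneg_eq_0_iff[of "{..<n}" "\<lambda>i. \<Sum>j<n. K $$ (i, j) * p $ j"] nonneg that by auto
  have pos: "p $ i > 0" if i: "i < n" for i
  proof (rule ccontr)
    assume "\<not> p $ i > 0"
    then have "p $ i = 0" using i by (simp add: p_def)
    have "p $ j = 0" if "j < n" for j
    proof (rule positively_connectedD[OF conn i that, of "\<lambda>i. p $ i = 0"])
      fix i j assume ij: "i < n" "j < n" "p $ i = 0" "K $$ (i, j) > 0"
      have "(\<Sum>j\<in>{..<n} - {i}. K $$ (i, j) * p $ j) = 0"
        using Kp[OF ij(1)] split[OF ij(1), of "\<lambda>j. K $$ (i, j) * p $ j"] ij(3) by simp
      then have "\<forall>j\<in>{..<n} - {i}. K $$ (i, j) * p $ j = 0"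
        using ij(1) off_diag by (subst (asm) sum_nonneg_eq_0_iff) (auto simp: p_def)
      then show "p $ j = 0" using ij by (cases "i = j") force+
    qed fact
    then have "v = 0\<^sub>v n" using v(1) by (auto simp: p_def intro!: eq_vecI)
    then show False using v(2) by simp
  qed
  show ?thesis
  proof
    show "K *\<^sub>v p = 0\<^sub>v n"
      by (rule eq_vecI) (use K p Kp in \<open>auto simp: mult_mat_vec_eq_sum[OF K p] simp del: index_mult_mat_vec\<close>)
  qed (use p pos in auto)
qed

section \<open>The Lyapunov form\<close>

text \<open>
  The matrix \<open>k\<^sub>i\<^sub>j p\<^sub>j\<close> has vanishing row sums and vanishing column sums, so both square terms
  disappear when \<open>(y\<^sub>i - y\<^sub>j)\<^sup>2\<close> is expanded.
\<close>

lemma dirichlet_form_identity: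
  fixes k :: "nat \<Rightarrow> nat \<Rightarrow> real"
  assumes col_sums: "\<And>j. j < n \<Longrightarrow> (\<Sum>i<n. k i j) = 0"
    and ker: "\<And>i. i < n \<Longrightarrow> (\<Sum>j<n. k i j * p j) = 0"
  shows "2 * (\<Sum>i<n. \<Sum>j<n. k i j * p j * y i * y j)
    = - (\<Sum>i<n. \<Sum>j<n. k i j * p j * (y i - y j)\<^sup>2)"
proof -
  have "k i j * p j * (y i - y j)\<^sup>2
      = k i j * p j * (y i)\<^sup>2 + k i j * p j * (y j)\<^sup>2 - 2 * (k i j * p j * y i * y j)" for i j
    by (simp add: power2_eq_square algebra_simps)
  then have "(\<Sum>i<n. \<Sum>j<n. k i j * p j * (y i - y j)\<^sup>2)
      = (\<Sum>i<n. \<Sum>j<n. k i j * p j * (y i)\<^sup>2) + (\<Sum>i<n. \<Sum>j<n. k i j * p j * (y j)\<^sup>2)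
        - 2 * (\<Sum>i<n. \<Sum>j<n. k i j * p j * y i * y j)"
    by (simp only: sum.distrib sum_subtractf sum_distrib_left)
  moreover have "(\<Sum>i<n. \<Sum>j<n. k i j * p j * (y i)\<^sup>2) = 0"
    using ker by (simp only: sum_distrib_right[symmetric]) simp
  moreover have "(\<Sum>i<n. \<Sum>j<n. k i j * p j * (y j)\<^sup>2) = 0"
    by (subst sum.swap) (use col_sums in \<open>simp only: sum_distrib_right[symmetric] mult.assoc, simp\<close>)
  ultimately show ?thesis by simp
qed

text \<open>
  The substitution \<open>v\<^sub>i = p\<^sub>i y\<^sub>i\<close> turns the quadratic form of \<open>A K + K\<^sup>T A\<close> into minus a
  Dirichlet form. When the off-diagonal entries of \<open>K\<close> are nonnegative, its sign and its null
  vectors can be read off from there.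
\<close>

lemma lyapunov_form:
  fixes K :: "real mat"
  assumes K: "K \<in> carrier_mat n n" and p: "p \<in> carrier_vec n" and v: "v \<in> carrier_vec n"
    and col_sums: "\<And>j. j < n \<Longrightarrow> (\<Sum>i<n. K $$ (i, j)) = 0"
    and Kp: "K *\<^sub>v p = 0\<^sub>v n" and pos: "\<And>i. i < n \<Longrightarrow> p $ i > 0"
  defines "A \<equiv> mat_diag n (\<lambda>i. 1 / p $ i)"
  shows "v \<bullet> ((A * K + transpose_mat K * A) *\<^sub>v v)
    = - (\<Sum>i<n. \<Sum>j<n. K $$ (i, j) * p $ j * (v $ i / p $ i - v $ j / p $ j)\<^sup>2)"
proof -
  define y where "y i = v $ i / p $ i" for i
  have A: "A \<in> carrier_mat n n" by (simp add: A_def)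
  have entry: "(A * K + transpose_mat K * A) $$ (i, j) = K $$ (i, j) / p $ i + K $$ (j, i) / p $ j"
    if "i < n" "j < n" for i j
    using that K by (simp add: A_def mat_diag_mult_left[of _ n n] mat_diag_mult_right[of _ n n])
  have "v \<bullet> ((A * K + transpose_mat K * A) *\<^sub>v v)
      = (\<Sum>i<n. v $ i * ((A * K + transpose_mat K * A) *\<^sub>v v) $ i)"
    using v A K by (simp add: scalar_prod_def lessThan_atLeast0)
  also have "\<dots> = (\<Sum>i<n. v $ i * (\<Sum>j<n. (K $$ (i, j) / p $ i + K $$ (j, i) / p $ j) * v $ j))"
  proof (rule sum.cong)
    fix i assume "i \<in> {..<n}"
    then show "v $ i * ((A * K + transpose_mat K * A) *\<^sub>v v) $ i
        = v $ i * (\<Sum>j<n. (K $$ (i, j) / p $ i + K $$ (j, i) / p $ j) * v $ j)"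
      using A K v by (subst mult_mat_vec_eq_sum[of _ n]) (auto simp: entry simp del: index_add_mat index_mult_mat)
  qed simp
  also have "\<dots> = (\<Sum>i<n. \<Sum>j<n. K $$ (i, j) / p $ i * v $ i * v $ j)
      + (\<Sum>i<n. \<Sum>j<n. K $$ (j, i) / p $ j * v $ i * v $ j)"
    by (simp add: sum_distrib_left sum.distrib distrib_left distrib_right mult_ac)
  also have "(\<Sum>i<n. \<Sum>j<n. K $$ (j, i) / p $ j * v $ i * v $ j)
      = (\<Sum>i<n. \<Sum>j<n. K $$ (i, j) / p $ i * v $ i * v $ j)"
    by (subst sum.swap) (simp add: mult_ac)
  also have "(\<Sum>i<n. \<Sum>j<n. K $$ (i, j) / p $ i * v $ i * v $ j)
      = (\<Sum>i<n. \<Sum>j<n. K $$ (i, j) * p $ j * y i * y j)"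
  proof (intro sum.cong refl)
    fix i j assume "i \<in> {..<n}" "j \<in> {..<n}"
    then have "p $ j \<noteq> 0" using pos[of j] by simp
    then show "K $$ (i, j) / p $ i * v $ i * v $ j = K $$ (i, j) * p $ j * y i * y j"
      by (simp add: y_def)
  qed
  also have "\<dots> + \<dots> = - (\<Sum>i<n. \<Sum>j<n. K $$ (i, j) * p $ j * (y i - y j)\<^sup>2)"
    using dirichlet_form_identity[of n "\<lambda>i j. K $$ (i, j)" "\<lambda>j. p $ j" y, OF col_sums]
      mult_mat_vec_eq_sum[OF K p] Kp by simp
  finally show ?thesis by (simp add: y_def)
qed

text \<open>
  A vector on which the form is not negative makes every term of the Dirichlet form vanish, so the
  ratio \<open>v\<^sub>i / p\<^sub>i\<close> does not change along positive entries of \<open>K\<close> and is constant.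
\<close>

lemma lyapunov_form_nonneg_imp_multiple:
  fixes K :: "real mat"
  assumes n: "n > 0" and K: "K \<in> carrier_mat n n" and p: "p \<in> carrier_vec n" and v: "v \<in> carrier_vec n"
    and off_diag: "\<And>i j. \<lbrakk>i < n; j < n; i \<noteq> j\<rbrakk> \<Longrightarrow> K $$ (i, j) \<ge> 0"
    and col_sums: "\<And>j. j < n \<Longrightarrow> (\<Sum>i<n. K $$ (i, j)) = 0"
    and conn: "positively_connected n K"
    and Kp: "K *\<^sub>v p = 0\<^sub>v n" and p_pos: "\<And>i. i < n \<Longrightarrow> p $ i > 0"
  defines "A \<equiv> mat_diag n (\<lambda>i. 1 / p $ i)"
  assumes nonneg: "v \<bullet> ((A * K + transpose_mat K * A) *\<^sub>v v) \<ge> 0"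
  shows "v = (v $ 0 / p $ 0) \<cdot>\<^sub>v p"
proof -
  have K_p: "K $$ (i, j) * p $ j \<ge> 0" if "i < n" "j < n" "i \<noteq> j" for i j
    using off_diag that p_pos[of j] by simp
  have term_nonneg: "K $$ (i, j) * p $ j * (v $ i / p $ i - v $ j / p $ j)\<^sup>2 \<ge> 0"
    if "i < n" "j < n" for i j
    using K_p[OF that] by (cases "i = j") auto
  have "(\<Sum>i<n. \<Sum>j<n. K $$ (i, j) * p $ j * (v $ i / p $ i - v $ j / p $ j)\<^sup>2) \<le> 0"
    using nonneg lyapunov_form[OF K p v col_sums Kp p_pos] by (simp add: A_def)
  then have "(\<Sum>i<n. \<Sum>j<n. K $$ (i, j) * p $ j * (v $ i / p $ i - v $ j / p $ j)\<^sup>2) = 0"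
    using term_nonneg by (intro antisym sum_nonneg) auto
  then have rows: "\<forall>i<n. (\<Sum>j<n. K $$ (i, j) * p $ j * (v $ i / p $ i - v $ j / p $ j)\<^sup>2) = 0"
    using term_nonneg by (subst (asm) sum_nonneg_eq_0_iff) (auto intro!: sum_nonneg)
  have zero: "K $$ (i, j) * p $ j * (v $ i / p $ i - v $ j / p $ j)\<^sup>2 = 0" if "i < n" "j < n" for i j
  proof -
    have "(\<Sum>j<n. K $$ (i, j) * p $ j * (v $ i / p $ i - v $ j / p $ j)\<^sup>2) = 0"
      using rows \<open>i < n\<close> by blast
    then have "\<forall>j\<in>{..<n}. K $$ (i, j) * p $ j * (v $ i / p $ i - v $ j / p $ j)\<^sup>2 = 0"
      by (subst (asm) sum_nonneg_eq_0_iff) (use term_nonneg \<open>i < n\<close> in auto)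
    then show ?thesis using \<open>j < n\<close> by blast
  qed
  have ratio: "v $ j / p $ j = v $ 0 / p $ 0" if j: "j < n" for j
  proof (rule positively_connectedD[OF conn _ j, of 0])
    fix i j assume ij: "i < n" "j < n" "v $ i / p $ i = v $ 0 / p $ 0" "K $$ (i, j) > 0"
    then show "v $ j / p $ j = v $ 0 / p $ 0"
      using zero[OF ij(1,2)] p_pos[OF ij(2)] by simp
  qed (use n in auto)
  show ?thesis
  proof (rule eq_vecI)
    fix i assume "i < dim_vec ((v $ 0 / p $ 0) \<cdot>\<^sub>v p)"
    then have i: "i < n" using p by simp
    then have "v $ i = v $ 0 / p $ 0 * p $ i" using ratio[OF i] p_pos[OF i] by (simp add: field_simps)
    then show "v $ i = ((v $ 0 / p $ 0) \<cdot>\<^sub>v p) $ i" using i p by simp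
  qed (use v p in auto)
qed

text \<open>
  Both halves vanish at \<open>p\<close>: \<open>K p = 0\<close>, and \<open>A p\<close> is the all-ones vector, which \<open>K\<^sup>T\<close> kills.
\<close>

lemma lyapunov_matrix_kernel:
  fixes K :: "real mat"
  assumes K: "K \<in> carrier_mat n n" and p: "p \<in> carrier_vec n"
    and col_sums: "\<And>j. j < n \<Longrightarrow> (\<Sum>i<n. K $$ (i, j)) = 0"
    and Kp: "K *\<^sub>v p = 0\<^sub>v n" and p_pos: "\<And>i. i < n \<Longrightarrow> p $ i > 0"
  defines "A \<equiv> mat_diag n (\<lambda>i. 1 / p $ i)"
  shows "(A * K + transpose_mat K * A) *\<^sub>v p = 0\<^sub>v n"
proof -
  have A: "A \<in> carrier_mat n n" by (simp add: A_def)
  have Ap: "A *\<^sub>v p = vec n (\<lambda>_. 1)"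
  proof (rule eq_vecI)
    fix i assume "i < dim_vec (vec n (\<lambda>_. 1 :: real))"
    then have i: "i < n" by simp
    have "(A *\<^sub>v p) $ i = (\<Sum>j<n. A $$ (i, j) * p $ j)" by (rule mult_mat_vec_eq_sum[OF A p i])
    also have "\<dots> = (\<Sum>j<n. if j = i then 1 else 0)"
      using i p_pos[OF i] by (intro sum.cong) (auto simp: A_def mat_diag_def)
    finally show "(A *\<^sub>v p) $ i = vec n (\<lambda>_. 1) $ i" using i by simp
  qed (use A in auto)
  have "transpose_mat K *\<^sub>v vec n (\<lambda>_. 1) = 0\<^sub>v n" by (rule transpose_mult_ones[OF K col_sums])
  moreover have "A *\<^sub>v 0\<^sub>v n = 0\<^sub>v n" using A by (intro eq_vecI) auto
  ultimately show "(A * K + transpose_mat K * A) *\<^sub>v p = 0\<^sub>v n"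
    using A K p Kp Ap by (simp add: add_mult_distrib_mat_vec[of _ n n] assoc_mult_mat_vec[of _ n n _ n])
qed

lemma mat_diag_diagonal: "diagonal_mat (mat_diag n f)"
  by (simp add: diagonal_mat_def mat_diag_def)

lemma pos_def_mat_diag:
  fixes f :: "nat \<Rightarrow> real"
  assumes "\<And>i. i < n \<Longrightarrow> f i > 0"
  shows "pos_def_mat n (mat_diag n f)"
  unfolding pos_def_mat_def
proof (intro conjI ballI impI)
  show "mat_diag n f \<in> carrier_mat n n" by simp
  show "transpose_mat (mat_diag n f) = mat_diag n f"
    by (rule eq_matI) (auto simp: mat_diag_def)
  fix v :: "real vec" assume v: "v \<in> carrier_vec n" "v \<noteq> 0\<^sub>v n"
  have ent: "(mat_diag n f *\<^sub>v v) $ i = f i * v $ i" if "i < n" for i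
  proof -
    have "(mat_diag n f *\<^sub>v v) $ i = (\<Sum>j<n. mat_diag n f $$ (i, j) * v $ j)"
      using that v by (intro mult_mat_vec_eq_sum) auto
    also have "\<dots> = (\<Sum>j<n. if j = i then f i * v $ i else 0)"
      using that by (intro sum.cong) (auto simp: mat_diag_def)
    finally show ?thesis using that by simp
  qed
  have "\<exists>i<n. v $ i \<noteq> 0"
  proof (rule ccontr)
    assume "\<not> ?thesis"
    then have "v = 0\<^sub>v n" using v(1) by (intro eq_vecI) auto
    then show False using v(2) by simp
  qed
  then obtain i where i: "i < n" "v $ i \<noteq> 0" by blast
  have "v \<bullet> (mat_diag n f *\<^sub>v v) = (\<Sum>i<n. v $ i * (mat_diag n f *\<^sub>v v) $ i)"
    by (simp add: scalar_prod_def lessThan_atLeast0 mat_diag_def)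
  also have "\<dots> = (\<Sum>i<n. f i * (v $ i)\<^sup>2)"
    by (rule sum.cong) (auto simp: ent power2_eq_square simp del: index_mult_mat_vec)
  also have "\<dots> > 0"
    by (rule sum_pos2[of _ i]) (use i assms in \<open>auto simp: less_imp_le\<close>)
  finally show "v \<bullet> (mat_diag n f *\<^sub>v v) > 0" .
qed

lemma mat_diag_commute:
  "mat_diag n f * mat_diag n g = mat_diag n g * mat_diag n (f :: nat \<Rightarrow> real)"
  by (simp add: mult.commute)

section \<open>Diagonalization of the Lyapunov matrix\<close>

text \<open>
  For nonzero \<open>x\<close> put \<open>z = (0, x)\<close>. Then \<open>x \<bullet> D x\<close> is the form of \<open>N\<close> at \<open>U z\<close>; were it not
  positive, \<open>U z\<close> would be a multiple of the first column of \<open>U\<close>, hence \<open>z\<close> a multiple of the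
  first basis vector, against \<open>x \<noteq> 0\<close>.
\<close>

lemma pos_def_diagonal_block:
  fixes N :: "real mat"
  assumes N: "N \<in> carrier_mat (Suc m) (Suc m)"
    and U: "real_orthogonal_mat (Suc m) U" and D: "D \<in> carrier_mat m m" "diagonal_mat D"
    and block: "transpose_mat U * N * U = four_block_mat (0\<^sub>m 1 1) (0\<^sub>m 1 m) (0\<^sub>m m 1) D"
    and pos: "\<And>v. \<lbrakk>v \<in> carrier_vec (Suc m); v \<bullet> (N *\<^sub>v v) \<le> 0\<rbrakk> \<Longrightarrow> \<exists>c. v = c \<cdot>\<^sub>v col U 0"
  shows "pos_def_mat m D"
  unfolding pos_def_mat_def
proof (intro conjI ballI impI)
  let ?n = "Suc m"
  have Uc: "U \<in> carrier_mat ?n ?n" and UU: "transpose_mat U * U = 1\<^sub>m ?n"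
    using U by (auto simp: real_orthogonal_mat_def)
  show "transpose_mat D = D"
  proof (rule eq_matI)
    fix i j assume "i < dim_row D" "j < dim_col D"
    then show "transpose_mat D $$ (i, j) = D $$ (i, j)"
      using D by (cases "i = j") (auto simp: diagonal_mat_def)
  qed (use D in auto)
  fix x :: "real vec" assume x: "x \<in> carrier_vec m" "x \<noteq> 0\<^sub>v m"
  show "x \<bullet> (D *\<^sub>v x) > 0"
  proof (rule ccontr)
    assume neg: "\<not> x \<bullet> (D *\<^sub>v x) > 0"
    define z where "z = 0\<^sub>v 1 @\<^sub>v x"
    have z: "z \<in> carrier_vec ?n" using x append_carrier_vec[of "0\<^sub>v 1" 1 x m] by (simp add: z_def)
    have Uz: "U *\<^sub>v z \<in> carrier_vec ?n" using Uc z by simp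
    have "(U *\<^sub>v z) \<bullet> (N *\<^sub>v (U *\<^sub>v z)) = z \<bullet> (transpose_mat U *\<^sub>v (N *\<^sub>v (U *\<^sub>v z)))"
      using transpose_vec_mult_scalar[of "transpose_mat U" ?n ?n "N *\<^sub>v (U *\<^sub>v z)" z] Uc N z by simp
    also have "\<dots> = z \<bullet> ((transpose_mat U * N * U) *\<^sub>v z)"
      using Uc N z by (simp add: assoc_mult_mat_vec[of _ ?n ?n _ ?n])
    also have "\<dots> = z \<bullet> (0\<^sub>v 1 @\<^sub>v D *\<^sub>v x)"
    proof -
      have "(transpose_mat U * N * U) *\<^sub>v z = (0\<^sub>m 1 1 *\<^sub>v 0\<^sub>v 1) @\<^sub>v D *\<^sub>v x"
        unfolding block z_def by (rule mult_mat_vec_split) (use D x in auto)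
      also have "0\<^sub>m 1 1 *\<^sub>v 0\<^sub>v 1 = (0\<^sub>v 1 :: real vec)" by (rule eq_vecI) auto
      finally show ?thesis by simp
    qed
    also have "\<dots> = x \<bullet> (D *\<^sub>v x)"
      unfolding z_def using x D by (subst scalar_prod_append[of _ 1 _ m]) auto
    finally have "(U *\<^sub>v z) \<bullet> (N *\<^sub>v (U *\<^sub>v z)) \<le> 0" using neg by simp
    then obtain c where c: "U *\<^sub>v z = c \<cdot>\<^sub>v col U 0" using pos[OF Uz] by blast
    have "z = transpose_mat U *\<^sub>v (U *\<^sub>v z)"
      using Uc z UU by (simp add: assoc_mult_mat_vec[of _ ?n ?n _ ?n, symmetric])
    also have "\<dots> = c \<cdot>\<^sub>v (transpose_mat U *\<^sub>v col U 0)"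
      unfolding c by (rule mult_mat_vec[of _ ?n ?n]) (use Uc in \<open>auto intro: col_carrier_vec\<close>)
    also have "transpose_mat U *\<^sub>v col U 0 = unit_vec ?n 0"
      using col_mult2[of "transpose_mat U" ?n ?n U ?n 0] Uc UU by simp
    finally have zc: "z $ i = (c \<cdot>\<^sub>v unit_vec ?n 0) $ i" for i by simp
    have "x $ i = 0" if "i < m" for i
      using zc[of "Suc i"] that x by (simp add: z_def)
    then have "x = 0\<^sub>v m" using x by (intro eq_vecI) auto
    then show False using x by simp
  qed
qed (use D in auto)

theorem lemma2p3:
  fixes r :: nat and K :: "real mat" and lam :: "nat \<Rightarrow> real"
  assumes r: "r \<ge> 1"
    and K: "K \<in> carrier_mat r r"
    and off_diag: "\<forall>i<r. \<forall>j<r. i \<noteq> j \<longrightarrow> K $$ (i, j) \<ge> 0"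
    and col_sums: "\<forall>j<r. (\<Sum>i<r. K $$ (i, j)) = 0"
    and chain: "\<forall>i0<r. \<forall>i1<r. i0 \<noteq> i1 \<longrightarrow>
      (\<exists>js :: nat list. js \<noteq> [] \<and> set js \<subseteq> {..<r} \<and> hd js = i0 \<and> last js = i1 \<and>
        (\<forall>m. Suc m < length js \<longrightarrow> K $$ (js ! m, js ! Suc m) > 0))"
  shows "\<exists>A0 P S :: real mat.
    pos_def_mat r A0 \<and> diagonal_mat A0 \<and>
    real_orthogonal_mat r P \<and>
    pos_def_mat (r - 1) S \<and> diagonal_mat S \<and>
    A0 * mat_diag r lam = mat_diag r lam * A0 \<and>
    A0 * K + transpose_mat K * A0 =
      - (transpose_mat P *
          four_block_mat (0\<^sub>m 1 1) (0\<^sub>m 1 (r - 1)) (0\<^sub>m (r - 1) 1) S * P) \<and>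
    col (transpose_mat P) 0 \<in> mat_kernel K"
proof -
  have conn: "positively_connected r K" by (rule positively_connected_if_chains[OF chain])
  obtain p where p: "p \<in> carrier_vec r" and Kp: "K *\<^sub>v p = 0\<^sub>v r" and p_pos: "\<And>i. i < r \<Longrightarrow> p $ i > 0"
    using positive_kernel_vector[OF _ K _ _ conn] r off_diag col_sums by auto
  define A where "A = mat_diag r (\<lambda>i. 1 / p $ i)"
  define N where "N = - (A * K + transpose_mat K * A)"
  define m where "m = r - 1"
  have rm: "r = Suc m" using r by (simp add: m_def)
  have A: "A \<in> carrier_mat r r" and A_sym: "transpose_mat A = A" and A_pos: "pos_def_mat r A"
    using pos_def_mat_diag[of r "\<lambda>i. 1 / p $ i"] p_pos by (auto simp: A_def pos_def_mat_def)
  have N: "N \<in> carrier_mat r r" using A K by (simp add: N_def)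
  have N_sym: "transpose_mat N = N"
  proof -
    have "transpose_mat (A * K + transpose_mat K * A) = transpose_mat K * A + A * K"
      using A K A_sym by (simp add: transpose_add[of _ r r] transpose_mult[of _ r r _ r])
    also have "\<dots> = A * K + transpose_mat K * A"
      using A K by (intro comm_add_mat[of _ r r]) auto
    finally show ?thesis by (simp add: N_def transpose_uminus)
  qed
  have N_form: "v \<bullet> (N *\<^sub>v v) = - (v \<bullet> ((A * K + transpose_mat K * A) *\<^sub>v v))"
    if "v \<in> carrier_vec r" for v
    unfolding N_def using A K that by (subst uminus_mult_mat_vec) auto
  have N_ker: "v = (v $ 0 / p $ 0) \<cdot>\<^sub>v p" if v: "v \<in> carrier_vec r" and "v \<bullet> (N *\<^sub>v v) \<le> 0" for v
    using lyapunov_form_nonneg_imp_multiple[OF _ K p v _ _ conn Kp p_pos] N_form[OF v] that r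
      off_diag col_sums by (simp add: A_def)
  have "(A * K + transpose_mat K * A) *\<^sub>v p = 0\<^sub>v r"
    unfolding A_def using lyapunov_matrix_kernel[OF K p _ Kp p_pos] col_sums by simp
  then have Np: "N *\<^sub>v p = 0\<^sub>v r"
    unfolding N_def using A K p by (subst uminus_mult_mat_vec) auto
  define s where "s = 1 / sqrt (p \<bullet> p)"
  define u where "u = s \<cdot>\<^sub>v p"
  have "p \<noteq> 0\<^sub>v r" using p_pos[of 0] r by auto
  then have pp: "p \<bullet> p > 0"
    using scalar_prod_self_eq_0_iff[OF p] scalar_prod_self_nonneg[of p] by linarith
  have u: "u \<in> carrier_vec r" "u \<bullet> u = 1" using p pp by (auto simp: u_def s_def)
  have "N *\<^sub>v u = 0 \<cdot>\<^sub>v u"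
    unfolding u_def using p Np by (auto simp: mult_mat_vec[OF N p] intro!: eq_vecI)
  then obtain U D where U: "real_orthogonal_mat r U" and U0: "col U 0 = u"
    and D: "D \<in> carrier_mat m m" "diagonal_mat D"
    and block: "transpose_mat U * N * U = four_block_mat (0 \<cdot>\<^sub>m 1\<^sub>m 1) (0\<^sub>m 1 m) (0\<^sub>m m 1) D"
    using orthogonal_diagonalization_from_eigenvector[of N m u 0] N N_sym u
      real_symmetric_orthogonally_diagonalizable[of _ m] unfolding rm by blast
  have "0 \<cdot>\<^sub>m 1\<^sub>m 1 = (0\<^sub>m 1 1 :: real mat)" by (rule eq_matI) auto
  with block have block: "transpose_mat U * N * U = four_block_mat (0\<^sub>m 1 1) (0\<^sub>m 1 m) (0\<^sub>m m 1) D"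
    by simp
  have D_pos: "pos_def_mat m D"
  proof (rule pos_def_diagonal_block[OF _ _ D block])
    fix v assume "v \<in> carrier_vec (Suc m)" "v \<bullet> (N *\<^sub>v v) \<le> 0"
    then have "v = (v $ 0 / p $ 0) \<cdot>\<^sub>v p" using N_ker rm by blast
    also have "\<dots> = (v $ 0 / p $ 0 / s) \<cdot>\<^sub>v u" using pp by (simp add: u_def s_def smult_smult_assoc)
    finally show "\<exists>c. v = c \<cdot>\<^sub>v col U 0" unfolding U0 by blast
  qed (use N U rm in auto)
  have Uc: "U \<in> carrier_mat r r" "transpose_mat U * U = 1\<^sub>m r" "U * transpose_mat U = 1\<^sub>m r"
    using U by (auto simp: real_orthogonal_mat_def)
  have "U * (transpose_mat U * N * U) * transpose_mat U = (U * transpose_mat U) * N * (U * transpose_mat U)"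
    using Uc(1) N by (simp add: assoc_mult_mat[of _ r r _ r _ r])
  also have "\<dots> = N" using Uc N by simp
  finally have "A * K + transpose_mat K * A
      = - (U * (transpose_mat U * N * U) * transpose_mat U)"
    by (simp add: N_def)
  then have "A * K + transpose_mat K * A
      = - (transpose_mat (transpose_mat U) *
          four_block_mat (0\<^sub>m 1 1) (0\<^sub>m 1 (r - 1)) (0\<^sub>m (r - 1) 1) D * transpose_mat U)"
    unfolding block by (simp add: rm)
  moreover have "col (transpose_mat (transpose_mat U)) 0 \<in> mat_kernel K"
    using K p Kp u by (intro mat_kernelI[OF K]) (auto simp: U0 u_def mult_mat_vec[OF K p])
  moreover have "real_orthogonal_mat r (transpose_mat U)"
    using Uc by (simp add: real_orthogonal_mat_def)
  moreover have "diagonal_mat A" by (simp add: A_def mat_diag_diagonal)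
  moreover have "A * mat_diag r lam = mat_diag r lam * A"
    unfolding A_def by (rule mat_diag_commute)
  ultimately show ?thesis
    using A_pos D D_pos unfolding m_def by blast
qed

end
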